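(* Let $\delta_0\in[1,\infty)$. Let $A$ be the first order, nodal, symmetric interior penalty discontinuous Galerkin (SIPG) discretization matrix with penalty parameter $\delta_0$ of the 1D Laplacian with periodic boundary conditions, and consider the two-level iteration with one presmoothing step using the point block-Jacobi smoother $D=D_p$ with relaxation parameter $\alpha\in\mathbb{R}$, whose error iteration operator is $$E_\alpha=(I-PA_0^{-1}RA)(I-\alpha D_p^{-1}A)$$ (all operators as defined in the context). Then the optimal relaxation parameter, i.e. the value of $\alpha$ that maximizes the error reduction of the two-level iteration by minimizing over $\alpha\in\mathbb{R}$ the spectral radius $\rho(\alpha)$ defined in the context, is $$\alpha_{\mathrm{opt}}=\frac{(2\delta_0-1)^2}{6\delta_0^2-6\delta_0+1}.$$
   Context: Mesh and unknowns. Let $J$ be an even positive integer and $h=1/J$. A discontinuous piecewise linear function on a uniform mesh with cells of length $h$ is described by its nodal values $v_j^+$ and $v_j^-$, the values at the left and right endpoint of cell $j$, respectively. The periodic problem is treated by local Fourier analysis, so grid functions $v=(v_j^+,v_j^-)_{j\in\mathbb{Z}}$ with complex values on the infinite uniform mesh are considered, and the operators below act on them. Operator $A$ (SIPG for $-u''$, polynomial degree $1$, penalty $\delta=\delta_0/h$): $$(Av)_j^+=\tfrac1{h^2}\left(-\tfrac12 v_{j-1}^+ +(1-\delta_0)v_{j-1}^- +\delta_0 v_j^+ -\tfrac12 v_{j+1}^+\right),$$ $$(Av)_j^-=\tfrac1{h^2}\left(-\tfrac12 v_{j-1}^- +\delta_0 v_j^- +(1-\delta_0)v_{j+1}^+ -\tfrac12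 v_{j+1}^-\right).$$ Point block-Jacobi smoother $D_p$ (couples the two values at the same node): $$(D_pv)_j^-=\tfrac1{h^2}\left(\delta_0v_j^-+(1-\delta_0)v_{j+1}^+\right),\qquad (D_pv)_{j+1}^+=\tfrac1{h^2}\left((1-\delta_0)v_j^-+\delta_0v_{j+1}^+\right).$$ Restriction $R$ to the coarse mesh whose cell $m$ is the union of fine cells $2m-1$ and $2m$: $$(Rv)_m^+=\tfrac12\left(v_{2m-1}^++\tfrac12v_{2m-1}^-+\tfrac12v_{2m}^+\right),\qquad (Rv)_m^-=\tfrac12\left(\tfrac12v_{2m-1}^-+\tfrac12v_{2m}^++v_{2m}^-\right).$$ Prolongation $P=2R^{\top}$ (linear interpolation), coarse operator $A_0=RAP$. Two-level iteration: $u^{(i+1)}=u^{(i)}+M^{-1}(f-Au^{(i)})$, where $M^{-1}g=y$ is computed by $x=\alpha D^{-1}g$, $y=x+PA_0^{-1}R(g-Ax)$. Its error iteration operator is $E_\alpha=I-M^{-1}A=(I-PA_0^{-1}RA)(I-\alpha D^{-1}A)$. Fourier blocks and spectral radius. For real $k\in[-J/2,J/2]$ let $F_k$ be the $4$-dimensional space of fine grid functions of the form $v_j^\pm=(a^\pm+(-1)^jb^\pm)e^{2\pi i kjh}$ with $a^\pm,b^\pm\in\mathbb{C}$ (frequencies $k$ and $k-J/2$), and $G_k$ the $2$-dimensional space of coarse grid functions $V_m^\pm=a^\pm e^{2\pi i k\,2mh}$. Then $A$ and $D$ map $F_k$ to itself, $R$ maps $F_k$ to $G_k$, $P$ maps $G_k$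 to $F_k$, and $A_0$ maps $G_k$ to itself; $D$ is invertible on $F_k$, and $A_0$ is invertible on $G_k$ for $k\notin\{0,\pm J/2\}$. Let $\widehat E_\alpha(k)$ be the restriction of $E_\alpha$ to $F_k$, a $4\times4$ matrix after choosing a basis. Define $$\rho(\alpha)=\sup\{\text{spectral radius of }\widehat E_\alpha(k): k\in[-J/2,J/2],\ k\notin\{0,\pm J/2\}\}.$$
   Formalization: "The value" is read as a minimizer for all δ₀ ≥ 1, with uniqueness asserted only for δ₀ > 1: at δ₀ = 1 one has ρ(α) = 1 for every α in (0,1], so the stated value α = 1 is a minimizer but not the only one. *)

theory Defs
  imports Complex_Main "HOL-Library.Extended_Real" "Jordan_Normal_Form.Spectral_Radius"
begin

text \<open>Nodal values on the infinite uniform mesh of width \<open>h = 1/J\<close>: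
  \<open>v j LeftEnd\<close> is \<open>v_j^+\<close> and \<open>v j RightEnd\<close> is \<open>v_j^-\<close>.\<close>

datatype endpoint = LeftEnd | RightEnd

type_synonym grid_fun = "int \<Rightarrow> endpoint \<Rightarrow> complex"

definition mesh_size :: "nat \<Rightarrow> real" where
  "mesh_size J = 1 / real J"

definition sipg :: "nat \<Rightarrow> real \<Rightarrow> grid_fun \<Rightarrow> grid_fun" where
  "sipg J \<delta>\<^sub>0 v = (\<lambda>j s. of_real (1 / (mesh_size J)\<^sup>2) *
     (case s of
        LeftEnd \<Rightarrow> - 1/2 * v (j - 1) LeftEnd + of_real (1 - \<delta>\<^sub>0) * v (j - 1) RightEnd
                   + of_real \<delta>\<^sub>0 * v j LeftEnd - 1/2 * v (j + 1) LeftEnd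
      | RightEnd \<Rightarrow> - 1/2 * v (j - 1) RightEnd + of_real \<delta>\<^sub>0 * v j RightEnd
                   + of_real (1 - \<delta>\<^sub>0) * v (j + 1) LeftEnd - 1/2 * v (j + 1) RightEnd))"

text \<open>Point block-Jacobi: the blocks couple \<open>v_j^-\<close> with \<open>v_{j+1}^+\<close>, the two values at a node.\<close>

definition point_jacobi :: "nat \<Rightarrow> real \<Rightarrow> grid_fun \<Rightarrow> grid_fun" where
  "point_jacobi J \<delta>\<^sub>0 v = (\<lambda>j s. of_real (1 / (mesh_size J)\<^sup>2) *
     (case s of
        LeftEnd \<Rightarrow> of_real (1 - \<delta>\<^sub>0) * v (j - 1) RightEnd + of_real \<delta>\<^sub>0 * v j LeftEnd
      | RightEnd \<Rightarrow> of_real \<delta>\<^sub>0 * v j RightEnd + of_real (1 - \<delta>\<^sub>0) * v (j + 1) LeftEnd))"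

definition restriction :: "grid_fun \<Rightarrow> grid_fun" where
  "restriction v = (\<lambda>m s. 1/2 *
     (case s of
        LeftEnd \<Rightarrow> v (2*m - 1) LeftEnd + 1/2 * v (2*m - 1) RightEnd + 1/2 * v (2*m) LeftEnd
      | RightEnd \<Rightarrow> 1/2 * v (2*m - 1) RightEnd + 1/2 * v (2*m) LeftEnd + v (2*m) RightEnd))"

definition unit_grid :: "int \<Rightarrow> endpoint \<Rightarrow> grid_fun" where
  "unit_grid j s = (\<lambda>i t. if i = j \<and> t = s then 1 else 0)"

text \<open>Transpose of the infinite matrix with entries \<open>T (unit_grid j s) m t\<close> (row \<open>(m, t)\<close>,
  column \<open>(j, s)\<close>). The sum runs over the nonzero entries of a column, so this is meaningful
  only for matrices with finitely many nonzero entries in each column.\<close>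

definition grid_transpose :: "(grid_fun \<Rightarrow> grid_fun) \<Rightarrow> grid_fun \<Rightarrow> grid_fun" where
  "grid_transpose T V = (\<lambda>j s.
     \<Sum>(m, t) | T (unit_grid j s) m t \<noteq> 0. T (unit_grid j s) m t * V m t)"

definition prolongation :: "grid_fun \<Rightarrow> grid_fun" where
  "prolongation V = (\<lambda>j s. 2 * grid_transpose restriction V j s)"

definition coarse_op :: "nat \<Rightarrow> real \<Rightarrow> grid_fun \<Rightarrow> grid_fun" where
  "coarse_op J \<delta>\<^sub>0 = restriction \<circ> sipg J \<delta>\<^sub>0 \<circ> prolongation"

text \<open>\<open>fine_wave J k\<close> is the coordinate isomorphism from \<open>\<complex>^4\<close> onto the fine space of
  frequency \<open>k\<close>; the coordinates are \<open>(a^+, a^-, b^+, b^-)\<close>.\<close>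

definition fine_wave :: "nat \<Rightarrow> real \<Rightarrow> complex vec \<Rightarrow> grid_fun" where
  "fine_wave J k c = (\<lambda>j s.
     (case s of
        LeftEnd \<Rightarrow> c $ 0 + (-1) powi j * c $ 2
      | RightEnd \<Rightarrow> c $ 1 + (-1) powi j * c $ 3)
     * exp (2 * of_real pi * \<i> * of_real (k * of_int j * mesh_size J)))"

definition fine_space :: "nat \<Rightarrow> real \<Rightarrow> grid_fun set" where
  "fine_space J k = fine_wave J k ` carrier_vec 4"

definition coarse_space :: "nat \<Rightarrow> real \<Rightarrow> grid_fun set" where
  "coarse_space J k =
     {\<lambda>m s. a s * exp (2 * of_real pi * \<i> * of_real (k * (2 * of_int m) * mesh_size J))
       | a :: endpoint \<Rightarrow> complex. True}"

text \<open>The error operator on the fine space of frequency \<open>k\<close>. Since the coarse operator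
  annihilates constants, it has no inverse on all grid functions; it is
  inverted as a map of the coarse space of frequency \<open>k\<close> to itself.\<close>

definition smoothing_op :: "nat \<Rightarrow> real \<Rightarrow> real \<Rightarrow> real \<Rightarrow> grid_fun \<Rightarrow> grid_fun" where
  "smoothing_op J \<delta>\<^sub>0 \<alpha> k v = (\<lambda>j s.
     v j s - of_real \<alpha> * inv_into (fine_space J k) (point_jacobi J \<delta>\<^sub>0) (sipg J \<delta>\<^sub>0 v) j s)"

definition coarse_correction :: "nat \<Rightarrow> real \<Rightarrow> real \<Rightarrow> grid_fun \<Rightarrow> grid_fun" where
  "coarse_correction J \<delta>\<^sub>0 k v = (\<lambda>j s.
     v j s - prolongation (inv_into (coarse_space J k) (coarse_op J \<delta>\<^sub>0)
                             (restriction (sipg J \<delta>\<^sub>0 v))) j s)"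

definition error_op :: "nat \<Rightarrow> real \<Rightarrow> real \<Rightarrow> real \<Rightarrow> grid_fun \<Rightarrow> grid_fun" where
  "error_op J \<delta>\<^sub>0 \<alpha> k = coarse_correction J \<delta>\<^sub>0 k \<circ> smoothing_op J \<delta>\<^sub>0 \<alpha> k"

definition error_symbol :: "nat \<Rightarrow> real \<Rightarrow> real \<Rightarrow> real \<Rightarrow> complex mat" where
  "error_symbol J \<delta>\<^sub>0 \<alpha> k = mat 4 4 (\<lambda>(r, c).
     inv_into (carrier_vec 4) (fine_wave J k)
       (error_op J \<delta>\<^sub>0 \<alpha> k (fine_wave J k (unit_vec 4 c))) $ r)"

text \<open>The supremum is taken in \<open>ereal\<close>, so that it is meaningful without knowing boundedness.\<close>

definition conv_factor :: "nat \<Rightarrow> real \<Rightarrow> real \<Rightarrow> ereal" where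
  "conv_factor J \<delta>\<^sub>0 \<alpha> =
     (SUP k \<in> {- real J / 2 .. real J / 2} - {0, real J / 2, - real J / 2}.
        ereal (spectral_radius (error_symbol J \<delta>\<^sub>0 \<alpha> k)))"

end

theory Submission
  imports Defs
begin

text \<open>
  At frequency \<open>k\<close>, with phase \<open>\<theta> = 2 \<pi> k / J\<close>, both \<open>A\<close> and \<open>D\<close> are diagonal in the basis of waves
  that are even or odd across the nodes. The coarse correction projects onto \<open>ker (R A)\<close>, so two of the
  four eigenvalues of the error operator vanish and the other two are \<open>1 - \<alpha> \<mu>\<close>, where \<open>\<mu>\<close> runs
  through the roots of a quadratic polynomial whose coefficients depend on \<open>x = cos\<^sup>2 \<theta>\<close> and
  \<open>L = 2 \<delta>\<^sub>0 - 1\<close>. The signs of this polynomial at \<open>m = 1 - 1/L\<^sup>2\<close>, \<open>1\<close> and \<open>2\<close> confine its roots to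
  \<open>[m, 2]\<close>, and as \<open>k\<close> tends to \<open>0\<close> the roots tend to \<open>m\<close> and \<open>2\<close>. Hence the convergence factor is
  \<open>max \<bar>1 - \<alpha> m\<bar> \<bar>1 - 2 \<alpha>\<bar>\<close>, which is smallest where both terms agree, at \<open>\<alpha> = 2 / (2 + m)\<close>. For
  \<open>\<delta>\<^sub>0 = 1\<close> we have \<open>m = 0\<close>, and the minimiser is not unique.
\<close>

section \<open>Phase of a single Fourier mode\<close>

locale fourier_mode =
  fixes J :: nat and \<delta>\<^sub>0 k :: real
  assumes J_pos: "J > 0"
    and penalty_ge_1: "\<delta>\<^sub>0 \<ge> 1"
    and frequency: "k \<in> {- real J / 2 .. real J / 2} - {0, real J / 2, - real J / 2}"
begin

definition \<theta> :: real where "\<theta> = 2 * pi * k / real J"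
definition c :: complex where "c = of_real (cos \<theta>)"
definition \<tau> :: complex where "\<tau> = \<i> * of_real (sin \<theta>)"
definition e :: complex where "e = cis \<theta>"
text \<open>The node blocks of \<open>point_jacobi\<close>, without the factor J^2, have eigenvalue
  1 on equal nodal values and eigenvalue \<open>L\<close> on opposite ones.\<close>

definition L :: complex where "L = of_real (2 * \<delta>\<^sub>0 - 1)"

text \<open>The excluded frequencies 0, J/2 and -J/2 are exactly the zeros of the sine for phases
  between -pi and pi.\<close>

lemma sin_theta_nonzero: "sin \<theta> \<noteq> 0"
proof -
  have *: "- pi < \<theta>" "\<theta> < pi" "\<theta> \<noteq> 0"
  proof -
    have "- (real J / 2) < k" "k < real J / 2" "k \<noteq> 0"
      using frequency by auto
    then have "2 * k / real J > - 1" "2 * k / real J < 1" "k \<noteq> 0"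
      using J_pos by (simp_all add: field_simps)
    then have "pi * (- 1) < pi * (2 * k / real J)" "pi * (2 * k / real J) < pi * 1" "k \<noteq> 0"
      using pi_gt_zero by (simp_all only: mult_less_cancel_left_pos) simp_all
    then show "- pi < \<theta>" "\<theta> < pi" "\<theta> \<noteq> 0"
      using J_pos by (simp_all add: \<theta>_def mult_ac)
  qed
  show ?thesis
  proof (cases "\<theta> > 0")
    case True
    then show ?thesis using * sin_gt_zero[of \<theta>] by simp
  next
    case False
    then show ?thesis using * sin_gt_zero[of "- \<theta>"] by simp
  qed
qed

lemma tau_nonzero: "\<tau> \<noteq> 0"
  using sin_theta_nonzero by (simp add: \<tau>_def)

lemma tau_squared: "\<tau> * \<tau> = c * c - 1"
proof -
  have "\<tau> * \<tau> = - of_real ((sin \<theta>)\<^sup>2)"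
    by (simp add: \<tau>_def power2_eq_square algebra_simps)
  also have "\<dots> = c * c - 1"
    unfolding sin_squared_eq by (simp add: c_def power2_eq_square)
  finally show ?thesis .
qed

lemma e_eq: "e = c + \<tau>"
  by (simp add: e_def c_def \<tau>_def complex_eq_iff)

lemma inverse_e_eq: "inverse e = c - \<tau>"
  by (simp add: e_def c_def \<tau>_def complex_eq_iff flip: cis_inverse)

lemma c_eq: "c = (e + inverse e) / 2"
  and tau_eq: "\<tau> = (e - inverse e) / 2"
  unfolding e_eq inverse_e_eq inverse_e_eq[unfolded e_eq] by simp_all

lemma e_nonzero [simp]: "e \<noteq> 0"
  by (simp add: e_def)

lemma L_nonzero: "L \<noteq> 0"
  using penalty_ge_1 by (simp add: L_def flip: of_real_mult of_real_diff)

text \<open>Up to the factor J^2/2 the eigenvalues of \<open>coarse_op\<close> are this number and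
  \<open>1 - c\<^sup>2\<close>. The first is
  \<open>2 * \<delta>\<^sub>0 - (cos \<theta>)\<^sup>2\<close>, hence at least 1; the second is
  \<open>(sin \<theta>)\<^sup>2\<close>, positive because of the excluded frequencies.\<close>

lemma K_nonzero: "L + 1 - c\<^sup>2 \<noteq> 0"
proof -
  have "(cos \<theta>)\<^sup>2 \<le> 1"
    by (simp add: abs_square_le_1)
  then have "2 * \<delta>\<^sub>0 - 1 + 1 - (cos \<theta>)\<^sup>2 > 0"
    using penalty_ge_1 by linarith
  moreover have "L + 1 - c\<^sup>2 = of_real (2 * \<delta>\<^sub>0 - 1 + 1 - (cos \<theta>)\<^sup>2)"
    by (simp add: L_def c_def)
  ultimately show ?thesis
    by (metis of_real_eq_0_iff less_irrefl)
qed

lemma one_minus_c_nonzero: "1 - c\<^sup>2 \<noteq> 0"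
  using tau_nonzero tau_squared by (auto simp: power2_eq_square)

lemma delta_eq: "of_real \<delta>\<^sub>0 = (L + 1) / 2"
  by (simp add: L_def)

text \<open>In these coordinates both \<open>sipg\<close> and \<open>point_jacobi\<close> are diagonal: \<open>p, s\<close> are the amplitudes
  of the waves that are continuous at the nodes (frequencies \<open>k\<close> and \<open>k - J/2\<close>), \<open>q, r\<close> those of
  the waves that change sign there.\<close>

definition mode :: "complex \<Rightarrow> complex \<Rightarrow> complex \<Rightarrow> complex \<Rightarrow> grid_fun" where
  "mode p q r s = (\<lambda>j t. (case t of
        LeftEnd \<Rightarrow> (p + q) + (-1) powi j * (r + s)
      | RightEnd \<Rightarrow> e * ((p - q) + (-1) powi j * (r - s))) * e powi j)"

text \<open>The coarse coordinates are chosen such that \<open>coarse_op\<close> is diagonal.\<close>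

definition coarse_mode :: "complex \<Rightarrow> complex \<Rightarrow> grid_fun" where
  "coarse_mode U V = (\<lambda>m t. (case t of
        LeftEnd \<Rightarrow> 2 * inverse e * (U + V)
      | RightEnd \<Rightarrow> 2 * e * (U - V)) * e powi (2 * m))"

section \<open>Fine and coarse spaces in wave coordinates\<close>

lemma exp_wave: "exp (2 * of_real pi * \<i> * of_real (k * of_int j * mesh_size J)) = e powi j"
proof -
  have "2 * of_real pi * \<i> * of_real (k * of_int j * mesh_size J) = \<i> * of_real (of_int j * \<theta>)"
    by (simp add: \<theta>_def mesh_size_def)
  then show ?thesis
    by (simp only: e_def cis_power_int flip: cis_conv_exp)
qed

lemma exp_coarse_wave:
  "exp (2 * of_real pi * \<i> * of_real (k * (2 * of_int m) * mesh_size J)) = e powi (2 * m)"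
  using exp_wave[of "2 * m"] by simp

lemma fine_wave_eq_mode:
  "fine_wave J k x = mode ((x $ 0 + inverse e * x $ 1) / 2) ((x $ 0 - inverse e * x $ 1) / 2)
                          ((x $ 2 + inverse e * x $ 3) / 2) ((x $ 2 - inverse e * x $ 3) / 2)"
  unfolding fine_wave_def mode_def exp_wave
  by (intro ext) (simp add: field_simps split: endpoint.split)

lemma mode_eq_fine_wave:
  "mode p q r s = fine_wave J k (vec_of_list [p + q, e * (p - q), r + s, e * (r - s)])"
  unfolding fine_wave_def mode_def exp_wave
  by (intro ext) (simp add: numeral_2_eq_2 numeral_3_eq_3 algebra_simps split: endpoint.split)

lemma mode_inject: "mode p q r s = mode p' q' r' s' \<longleftrightarrow> p = p' \<and> q = q' \<and> r = r' \<and> s = s'"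
proof
  assume eq: "mode p q r s = mode p' q' r' s'"
  have "mode p q r s j t = mode p' q' r' s' j t" for j t
    by (simp add: eq)
  \<comment> \<open>The sign \<open>(-1) powi j\<close> takes both values on cells 0 and 1, so their
    four nodal values determine the four amplitudes.\<close>
  note * = this[of 0 LeftEnd] this[of 0 RightEnd] this[of 1 LeftEnd] this[of 1 RightEnd]
  have "p + q + (r + s) = p' + q' + (r' + s')" "p - q + (r - s) = p' - q' + (r' - s')"
    "p + q + (- r - s) = p' + q' + (- r' - s')" "p - q + (s - r) = p' - q' + (s' - r')"
    using * by (simp_all add: mode_def)
  then show "p = p' \<and> q = q' \<and> r = r' \<and> s = s'"
    by (auto simp: complex_eq_iff)
qed auto

lemma coarse_mode_inject: "coarse_mode U V = coarse_mode U' V' \<longleftrightarrow> U = U' \<and> V = V'"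
proof
  assume eq: "coarse_mode U V = coarse_mode U' V'"
  have "coarse_mode U V 0 t = coarse_mode U' V' 0 t" for t
    by (simp add: eq)
  from this[of LeftEnd] this[of RightEnd]
  have "U + V = U' + V'" "U - V = U' - V'"
    by (simp_all add: coarse_mode_def)
  then show "U = U' \<and> V = V'"
    by (auto simp: complex_eq_iff)
qed auto

lemma fine_space_eq: "fine_space J k = {mode p q r s | p q r s. True}"
proof (intro equalityI subsetI)
  fix v assume "v \<in> fine_space J k"
  then show "v \<in> {mode p q r s | p q r s. True}"
    unfolding fine_space_def using fine_wave_eq_mode by blast
next
  fix v assume "v \<in> {mode p q r s | p q r s. True}"
  then obtain p q r s where "v = mode p q r s" by blast
  moreover have "vec_of_list [p + q, e * (p - q), r + s, e * (r - s)] \<in> carrier_vec 4"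
    by (rule carrier_vecI) (simp only: dim_vec_of_list, simp)
  ultimately show "v \<in> fine_space J k"
    unfolding fine_space_def mode_eq_fine_wave by blast
qed

lemma coarse_space_eq: "coarse_space J k = {coarse_mode U V | U V. True}"
proof (intro equalityI subsetI)
  fix v assume "v \<in> coarse_space J k"
  then obtain a where v: "v = (\<lambda>m s. a s * e powi (2 * m))"
    unfolding coarse_space_def exp_coarse_wave by blast
  have "v = coarse_mode ((e * a LeftEnd + inverse e * a RightEnd) / 4)
                        ((e * a LeftEnd - inverse e * a RightEnd) / 4)"
    unfolding v coarse_mode_def by (intro ext) (simp add: field_simps split: endpoint.split)
  then show "v \<in> {coarse_mode U V | U V. True}" by blast
next
  fix v assume "v \<in> {coarse_mode U V | U V. True}"
  then obtain U V where v: "v = coarse_mode U V" by blast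
  show "v \<in> coarse_space J k"
    unfolding coarse_space_def exp_coarse_wave v coarse_mode_def mem_Collect_eq
    by (rule exI[where x = "case_endpoint (2 * inverse e * (U + V)) (2 * e * (U - V))"]) simp
qed

section \<open>Fourier symbols of the grid operators\<close>

lemma minus_one_powi_shift: "(-1 :: complex) powi (j - 1) = - ((-1) powi j)"
    "(-1 :: complex) powi (j + 1) = - ((-1) powi j)"
  by (simp_all add: power_int_diff power_int_add)

lemma e_powi_shift: "e powi (j - 1) = e powi j * inverse e" "e powi (j + 1) = e powi j * e"
  by (simp_all add: power_int_diff power_int_add divide_inverse)

lemma mesh_factor: "of_real (1 / (mesh_size J)\<^sup>2) = (of_nat J)\<^sup>2"
  by (simp add: mesh_size_def power_divide)

text \<open>\<open>sipg\<close> is \<open>point_jacobi\<close> minus J^2/2 times the sum of the two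
  shifts by one cell. A forward shift multiplies the waves of \<open>p\<close>, \<open>q\<close> by
  \<open>e\<close> and those of \<open>r\<close>, \<open>s\<close> by \<open>- e\<close>, so the
  shifts contribute \<open>- c\<close> and \<open>c\<close> respectively, while the node blocks
  contribute 1 or \<open>L\<close>.\<close>

lemma sipg_mode:
  "sipg J \<delta>\<^sub>0 (mode p q r s) = mode ((of_nat J)\<^sup>2 * ((1 - c) * p)) ((of_nat J)\<^sup>2 * ((L - c) * q))
                               ((of_nat J)\<^sup>2 * ((L + c) * r)) ((of_nat J)\<^sup>2 * ((1 + c) * s))"
proof (intro ext)
  fix j :: int and t
  define z where "z = (-1 :: complex) powi j"
  define E where "E = e powi j"
  \<comment> \<open>With \<open>e\<close> and its inverse as two symbols related only by a product
    equal to 1, the claim becomes a polynomial identity.\<close>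
  define a b where "a = e" and "b = inverse e"
  have ab: "a * b = 1" "a * (b * y) = y" for y
    by (simp_all add: a_def b_def)
  note * = c_eq[folded a_def b_def] tau_eq[folded a_def b_def]
  show "sipg J \<delta>\<^sub>0 (mode p q r s) j t = mode ((of_nat J)\<^sup>2 * ((1 - c) * p))
     ((of_nat J)\<^sup>2 * ((L - c) * q)) ((of_nat J)\<^sup>2 * ((L + c) * r)) ((of_nat J)\<^sup>2 * ((1 + c) * s)) j t"
    unfolding sipg_def mode_def mesh_factor minus_one_powi_shift e_powi_shift of_real_diff delta_eq
      z_def[symmetric] E_def[symmetric]
    unfolding b_def[symmetric] unfolding a_def[symmetric] *
    by (cases t) (simp_all add: field_simps ab)
qed

lemma point_jacobi_mode:
  "point_jacobi J \<delta>\<^sub>0 (mode p q r s) = mode ((of_nat J)\<^sup>2 * p) ((of_nat J)\<^sup>2 * (L * q))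
                               ((of_nat J)\<^sup>2 * (L * r)) ((of_nat J)\<^sup>2 * s)"
proof (intro ext)
  fix j :: int and t
  define z where "z = (-1 :: complex) powi j"
  define E where "E = e powi j"
  define a b where "a = e" and "b = inverse e"
  have ab: "a * b = 1" "a * (b * y) = y" for y
    by (simp_all add: a_def b_def)
  note * = c_eq[folded a_def b_def] tau_eq[folded a_def b_def]
  show "point_jacobi J \<delta>\<^sub>0 (mode p q r s) j t = mode ((of_nat J)\<^sup>2 * p) ((of_nat J)\<^sup>2 * (L * q))
                               ((of_nat J)\<^sup>2 * (L * r)) ((of_nat J)\<^sup>2 * s) j t"
    unfolding point_jacobi_def mode_def mesh_factor minus_one_powi_shift e_powi_shift of_real_diff
      delta_eq z_def[symmetric] E_def[symmetric]
    unfolding b_def[symmetric] unfolding a_def[symmetric] *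
    by (cases t) (simp_all add: field_simps ab)
qed

text \<open>The sign \<open>(-1) powi j\<close> is constant on all even cells and on all odd cells,
  so the frequencies k and k - J/2 alias to the same coarse wave and four amplitudes fold into
  two.\<close>

lemma restriction_mode:
  "restriction (mode p q r s) =
     coarse_mode ((p - s + c * (p + s)) / 4) ((q - r + \<tau> * (p + s)) / 4)"
proof (intro ext)
  fix m t
  define E where "E = e powi (2 * m)"
  define a b where "a = e" and "b = inverse e"
  have ab: "a * b = 1" "a * (b * y) = y" for y
    by (simp_all add: a_def b_def)
  note * = c_eq[folded a_def b_def] tau_eq[folded a_def b_def]
  have z: "(-1 :: complex) powi (2 * m) = 1"
    by (simp add: power_int_mult)
  show "restriction (mode p q r s) m t =
     coarse_mode ((p - s + c * (p + s)) / 4) ((q - r + \<tau> * (p + s)) / 4) m t"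
    unfolding restriction_def mode_def coarse_mode_def minus_one_powi_shift e_powi_shift z
      E_def[symmetric]
    unfolding b_def[symmetric] unfolding a_def[symmetric] *
    by (cases t) (simp_all add: field_simps ab)
qed

end

text \<open>Fine cells \<open>2 * n\<close> and \<open>2 * n - 1\<close> make up coarse cell
  \<open>n\<close>, so a column of the restriction at either of them has entries only there. The sum
  in \<open>grid_transpose\<close> may therefore run over both endpoints of cell \<open>n\<close>,
  zero entries adding nothing.\<close>

lemma prolongation_even:
  "prolongation V (2 * n) LeftEnd = (V n LeftEnd + V n RightEnd) / 2"
  "prolongation V (2 * n) RightEnd = V n RightEnd"
  and prolongation_odd:
  "prolongation V (2 * n - 1) LeftEnd = V n LeftEnd"
  "prolongation V (2 * n - 1) RightEnd = (V n LeftEnd + V n RightEnd) / 2"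
proof -
  have transpose: "grid_transpose restriction V j s =
      (\<Sum>(m, t) \<in> {(n, LeftEnd), (n, RightEnd)}. restriction (unit_grid j s) m t * V m t)"
    if "j = 2 * n \<or> j = 2 * n - 1" for j s
    unfolding grid_transpose_def
  proof (rule sum.mono_neutral_left)
    show "{(m, t). restriction (unit_grid j s) m t \<noteq> 0} \<subseteq> {(n, LeftEnd), (n, RightEnd)}"
    proof
      fix x
      assume "x \<in> {(m, t). restriction (unit_grid j s) m t \<noteq> 0}"
      then obtain m t where x: "x = (m, t)" and nz: "restriction (unit_grid j s) m t \<noteq> 0"
        by blast
      have "m = n"
      proof (rule ccontr)
        assume "m \<noteq> n"
        then have "2 * m \<noteq> j" "2 * m - 1 \<noteq> j"
          using that by presburger+
        then show False
          using nz by (auto simp: restriction_def unit_grid_def split: endpoint.splits)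
      qed
      then show "x \<in> {(n, LeftEnd), (n, RightEnd)}"
        using x by (cases t) auto
    qed
  qed auto
  have odd: "2 * n \<noteq> 2 * n - 1" "2 * n - 1 \<noteq> 2 * n"
    by presburger+
  show "prolongation V (2 * n) LeftEnd = (V n LeftEnd + V n RightEnd) / 2"
    "prolongation V (2 * n) RightEnd = V n RightEnd"
    "prolongation V (2 * n - 1) LeftEnd = V n LeftEnd"
    "prolongation V (2 * n - 1) RightEnd = (V n LeftEnd + V n RightEnd) / 2"
    by (simp_all add: prolongation_def transpose restriction_def unit_grid_def odd field_simps)
qed

text \<open>Up to a factor, this is \<open>det (N\<^sup>* D\<^sup>-\<^sup>1 N - \<mu> N\<^sup>* A\<^sup>-\<^sup>1 N)\<close>, where the columns of \<open>N\<close> span the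
  kernel of the restriction, \<open>L = 2 \<delta>\<^sub>0 - 1\<close>, and \<open>x\<close> is the squared cosine of the phase.\<close>

definition symbol_poly :: "'a :: comm_ring_1 \<Rightarrow> 'a \<Rightarrow> 'a \<Rightarrow> 'a" where
  "symbol_poly L x \<mu> = L\<^sup>2 * (L + 1 - x) * \<mu>\<^sup>2 - (L\<^sup>2 * (2 * L + 2) + x * (L^3 - 2 * L\<^sup>2 - L)) * \<mu>
     + (L * (1 + x) + 1 - x) * (L\<^sup>2 - x)"

section \<open>The quadratic polynomial and the location of its roots\<close>

lemma symbol_poly_of_real:
  "symbol_poly (of_real L) (of_real x) (of_real \<mu> :: complex) = of_real (symbol_poly L x \<mu>)"
  by (simp add: symbol_poly_def)

text \<open>In this grouping the factor \<open>L\<^sup>2 * (\<mu> - 1) + x\<close> is the amplitude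
  \<open>p\<close> of the eigenvector built in \<open>eigenvalue_of_root\<close>.\<close>

lemma symbol_poly_alt:
  "- symbol_poly L x \<mu> = L * (1 + x - \<mu>) * (L\<^sup>2 * (\<mu> - 1) + x) + (x - 1) * (L\<^sup>2 * (\<mu> - 1)\<^sup>2 - x)"
  unfolding symbol_poly_def by (simp add: algebra_simps power2_eq_square power3_eq_cube)

text \<open>The left-hand side is the determinant of the system in \<open>p\<close>,
  \<open>q\<close>, \<open>r\<close>. Multiplying the equations by the entries of the adjugate shows
  that it annihilates each unknown, one of which is nonzero.\<close>

lemma singular_system:
  fixes p q r t A B M a b :: "'a :: idom"
  assumes "t * A * q = M * p" and "A * q + B * r = 0" and "b * q - a * r + 2 * t * p = 0"
    and "(p, q, r) \<noteq> (0, 0, 0)"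
  shows "M * (A * a + B * b) + 2 * t\<^sup>2 * A * B = 0"
proof -
  define D where "D = M * (A * a + B * b) + 2 * t\<^sup>2 * A * B"
  have 1: "t * A * q - M * p = 0"
    using assms(1) by simp
  have "D * p = - (A * a + B * b) * (t * A * q - M * p) + t * A * a * (A * q + B * r)
      + t * A * B * (b * q - a * r + 2 * t * p)"
    unfolding D_def by (simp add: algebra_simps power2_eq_square)
  moreover have "D * q = 2 * t * B * (t * A * q - M * p) + M * a * (A * q + B * r)
      + M * B * (b * q - a * r + 2 * t * p)"
    unfolding D_def by (simp add: algebra_simps power2_eq_square)
  moreover have "D * r = - 2 * t * A * (t * A * q - M * p) + (M * b + 2 * t\<^sup>2 * A) * (A * q + B * r)
      - M * A * (b * q - a * r + 2 * t * p)"
    unfolding D_def by (simp add: algebra_simps power2_eq_square)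
  ultimately show ?thesis
    using assms(4) unfolding 1 assms(2,3) by (auto simp flip: D_def)
qed

text \<open>A convex parabola that is nonpositive at \<open>n\<close> has only real roots, and a
  root outside the interval would contradict the sign at the nearer endpoint.\<close>

lemma quadratic_root_in_interval:
  fixes a b d m n M :: real and z :: complex
  assumes "a > 0" and "m < n" "n < M"
    and m: "a * m\<^sup>2 - b * m + d \<ge> 0" and n: "a * n\<^sup>2 - b * n + d \<le> 0" and M: "a * M\<^sup>2 - b * M + d \<ge> 0"
    and root: "of_real a * z\<^sup>2 - of_real b * z + of_real d = 0"
  obtains u where "z = of_real u" and "u \<in> {m..M}"
proof -
  define u v where "u = Re z" and "v = Im z"
  have re: "a * (u\<^sup>2 - v\<^sup>2) - b * u + d = 0" and im: "v * (2 * a * u - b) = 0"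
    using root by (simp_all add: complex_eq_iff u_def v_def power2_eq_square algebra_simps)
  have v: "v = 0"
  proof (rule ccontr)
    assume "v \<noteq> 0"
    then have "b = 2 * a * u" using im by simp
    \<comment> \<open>A nonreal root has its conjugate as partner, so completing the square leaves
      no real zero.\<close>
    then have "a * n\<^sup>2 - b * n + d = a * ((n - u)\<^sup>2 + v\<^sup>2)"
      using re by (simp add: power2_eq_square algebra_simps)
    moreover have "a * ((n - u)\<^sup>2 + v\<^sup>2) > 0"
      using \<open>a > 0\<close> \<open>v \<noteq> 0\<close> by (intro mult_pos_pos add_nonneg_pos) auto
    ultimately show False using n by simp
  qed
  have P: "a * u\<^sup>2 - b * u + d = 0"
    using re v by simp
  \<comment> \<open>The second divided difference of the quadratic over the points \<open>y\<close>,
    \<open>n\<close>, \<open>u\<close> equals its leading coefficient \<open>a\<close>; this is that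
    fact with denominators cleared.\<close>
  have chord: "(a * y\<^sup>2 - b * y + d) * (n - u) = (a * u\<^sup>2 - b * u + d) * (n - y)
      + (a * n\<^sup>2 - b * n + d) * (y - u) - a * ((n - u) * (n - y) * (y - u))" for y
    by (simp add: power2_eq_square algebra_simps)
  have "m \<le> u"
  proof (rule ccontr)
    assume "\<not> m \<le> u"
    then have "u < m" by simp
    have "(a * m\<^sup>2 - b * m + d) * (n - u) \<ge> 0"
      using m \<open>u < m\<close> \<open>m < n\<close> by (intro mult_nonneg_nonneg) auto
    moreover have "(a * n\<^sup>2 - b * n + d) * (m - u) \<le> 0"
      using n \<open>u < m\<close> by (intro mult_nonpos_nonneg) auto
    moreover have "a * ((n - u) * (n - m) * (m - u)) > 0"
      using \<open>a > 0\<close> \<open>u < m\<close> \<open>m < n\<close> by (intro mult_pos_pos) auto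
    ultimately show False
      using chord[of m] unfolding P by linarith
  qed
  moreover have "u \<le> M"
  proof (rule ccontr)
    assume "\<not> u \<le> M"
    then have "M < u" by simp
    have "(a * M\<^sup>2 - b * M + d) * (n - u) \<le> 0"
      using M \<open>M < u\<close> \<open>n < M\<close> by (intro mult_nonneg_nonpos) auto
    moreover have "(a * n\<^sup>2 - b * n + d) * (M - u) \<ge> 0"
      using n \<open>M < u\<close> by (intro mult_nonpos_nonpos) auto
    moreover have "a * ((n - u) * (n - M) * (M - u)) < 0"
      using \<open>a > 0\<close> \<open>M < u\<close> \<open>n < M\<close> by (intro mult_pos_neg mult_neg_neg) auto
    ultimately show False
      using chord[of M] unfolding P by linarith
  qed
  moreover have "z = of_real u"
    using v by (simp add: complex_eq_iff u_def v_def)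
  ultimately show ?thesis
    using that by simp
qed

context
  fixes L x :: real
  assumes L: "L \<ge> 1" and x: "0 \<le> x" "x \<le> 1"
begin

lemma symbol_poly_at_1: "symbol_poly L x 1 \<le> 0"
proof -
  have "symbol_poly L x 1 = - (x * (1 + x * (L - 1)))"
    by (simp add: symbol_poly_def algebra_simps power2_eq_square power3_eq_cube)
  then show ?thesis
    using L x by simp
qed

text \<open>The number 2 and the lower endpoint \<open>1 - 1 / L\<^sup>2\<close> are the roots for
  \<open>x\<close> equal to 1, so at both of them a factor \<open>1 - x\<close> splits off and the
  cofactor is visibly nonnegative.\<close>

lemma symbol_poly_at_2: "symbol_poly L x 2 \<ge> 0"
proof -
  have "symbol_poly L x 2 = (1 - x) * (L^3 + L\<^sup>2 + x * (L - 1))"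
    by (simp add: symbol_poly_def algebra_simps power2_eq_square power3_eq_cube)
  then show ?thesis
    using L x by simp
qed

lemma symbol_poly_at_min: "symbol_poly L x (1 - 1 / L\<^sup>2) \<ge> 0"
proof -
  have "L\<^sup>2 * symbol_poly L x (1 - 1 / L\<^sup>2) = (1 - x) * (L + 1 + x * L\<^sup>2 * (L - 1))"
    using L by (simp add: symbol_poly_def field_simps power2_eq_square power3_eq_cube)
  also have "\<dots> \<ge> 0"
    using L x by simp
  finally show ?thesis
    using L by (simp add: zero_le_mult_iff)
qed

lemma symbol_poly_root_range:
  assumes "symbol_poly (of_real L) (of_real x) (z :: complex) = 0"
  obtains u where "z = of_real u" and "u \<in> {1 - 1 / L\<^sup>2 .. 2}"
proof (rule quadratic_root_in_interval)
  show "L\<^sup>2 * (L + 1 - x) > 0"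
    using L x by (intro mult_pos_pos) auto
  show "1 - 1 / L\<^sup>2 < 1" "(1 :: real) < 2"
    using L by simp_all
  let ?d = "(L * (1 + x) + 1 - x) * (L\<^sup>2 - x)"
  show "L\<^sup>2 * (L + 1 - x) * (1 - 1 / L\<^sup>2)\<^sup>2
      - (L\<^sup>2 * (2 * L + 2) + x * (L^3 - 2 * L\<^sup>2 - L)) * (1 - 1 / L\<^sup>2) + ?d \<ge> 0"
    using symbol_poly_at_min unfolding symbol_poly_def .
  show "L\<^sup>2 * (L + 1 - x) * 1\<^sup>2
      - (L\<^sup>2 * (2 * L + 2) + x * (L^3 - 2 * L\<^sup>2 - L)) * 1 + ?d \<le> 0"
    using symbol_poly_at_1 unfolding symbol_poly_def .
  show "L\<^sup>2 * (L + 1 - x) * 2\<^sup>2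
      - (L\<^sup>2 * (2 * L + 2) + x * (L^3 - 2 * L\<^sup>2 - L)) * 2 + ?d \<ge> 0"
    using symbol_poly_at_2 unfolding symbol_poly_def .
  show "of_real (L\<^sup>2 * (L + 1 - x)) * z\<^sup>2
      - of_real (L\<^sup>2 * (2 * L + 2) + x * (L^3 - 2 * L\<^sup>2 - L)) * z + of_real ?d = 0"
    using assms unfolding symbol_poly_def by simp
qed (use that in blast)

end

text \<open>The squared cosine 1 belongs to the excluded frequency 0. The two roots found here are
  only approached by admissible frequencies.\<close>

lemma symbol_poly_limit:
  fixes L \<mu> :: real
  assumes "L \<noteq> 0"
  shows "symbol_poly L 1 \<mu> = L^3 * ((\<mu> - 2) * (\<mu> - (1 - 1 / L\<^sup>2)))"
  using assms by (simp add: symbol_poly_def field_simps power2_eq_square power3_eq_cube)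

context fourier_mode
begin

section \<open>Coarse-grid correction and smoothing in wave coordinates\<close>

lemma prolongation_coarse_mode:
  "prolongation (coarse_mode U V) =
     mode ((1 + c) * U - \<tau> * V) V (- V) (- ((1 - c) * U) - \<tau> * V)"
proof (intro ext)
  fix j :: int and t
  define a b where "a = e" and "b = inverse e"
  have ab: "a * b = 1" "a * (b * y) = y" for y
    by (simp_all add: a_def b_def)
  note * = c_eq[folded a_def b_def] tau_eq[folded a_def b_def]
  define E where "E n = e powi (2 * n)" for n
  have z: "(-1 :: complex) powi (2 * n) = 1" for n
    by (simp add: power_int_mult)
  have "\<exists>n. j = 2 * n \<or> j = 2 * n - 1"
    by presburger
  then obtain n where "j = 2 * n \<or> j = 2 * n - 1"
    by blast
  then show "prolongation (coarse_mode U V) j t =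
     mode ((1 + c) * U - \<tau> * V) V (- V) (- ((1 - c) * U) - \<tau> * V) j t"
  proof
    assume j: "j = 2 * n"
    show ?thesis
    proof (cases t)
      case LeftEnd
      show ?thesis
        unfolding j LeftEnd prolongation_even mode_def coarse_mode_def endpoint.case
          z E_def[symmetric]
        unfolding b_def[symmetric] unfolding a_def[symmetric] *
        by (simp add: field_simps ab)
    next
      case RightEnd
      show ?thesis
        unfolding j RightEnd prolongation_even mode_def coarse_mode_def endpoint.case
          z E_def[symmetric]
        unfolding b_def[symmetric] unfolding a_def[symmetric] *
        by (simp add: field_simps ab)
    qed
  next
    assume j: "j = 2 * n - 1"
    show ?thesis
    proof (cases t)
      case LeftEnd
      show ?thesis
        unfolding j LeftEnd prolongation_odd mode_def coarse_mode_def endpoint.case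
          minus_one_powi_shift e_powi_shift z E_def[symmetric]
        unfolding b_def[symmetric] unfolding a_def[symmetric] *
        by (simp add: field_simps ab)
    next
      case RightEnd
      show ?thesis
        unfolding j RightEnd prolongation_odd mode_def coarse_mode_def endpoint.case
          minus_one_powi_shift e_powi_shift z E_def[symmetric]
        unfolding b_def[symmetric] unfolding a_def[symmetric] *
        by (simp add: field_simps ab)
    qed
  qed
qed

lemma coarse_op_mode:
  "coarse_op J \<delta>\<^sub>0 (coarse_mode U V) =
     coarse_mode ((of_nat J)\<^sup>2 * (1 - c\<^sup>2) / 2 * U) ((of_nat J)\<^sup>2 * (L + 1 - c\<^sup>2) / 2 * V)"
proof -
  have t: "\<tau> * (\<tau> * y) = (c * c - 1) * y" for y
    by (simp add: tau_squared flip: mult.assoc)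
  show ?thesis
    unfolding coarse_op_def comp_def prolongation_coarse_mode sipg_mode restriction_mode
      coarse_mode_inject
    by (simp add: field_simps power2_eq_square tau_squared t)
qed

lemma inv_coarse_op_mode:
  "inv_into (coarse_space J k) (coarse_op J \<delta>\<^sub>0)
     (coarse_mode ((of_nat J)\<^sup>2 * U) ((of_nat J)\<^sup>2 * V)) =
   coarse_mode (2 * U / (1 - c\<^sup>2)) (2 * V / (L + 1 - c\<^sup>2))"
proof (rule inv_into_f_eq)
  show "inj_on (coarse_op J \<delta>\<^sub>0) (coarse_space J k)"
    using J_pos K_nonzero one_minus_c_nonzero
    unfolding inj_on_def coarse_space_eq
    by (auto simp del: power2_eq_1_iff simp add: coarse_op_mode coarse_mode_inject)
  show "coarse_mode (2 * U / (1 - c\<^sup>2)) (2 * V / (L + 1 - c\<^sup>2)) \<in> coarse_space J k"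
    unfolding coarse_space_eq by blast
  show "coarse_op J \<delta>\<^sub>0 (coarse_mode (2 * U / (1 - c\<^sup>2)) (2 * V / (L + 1 - c\<^sup>2))) =
      coarse_mode ((of_nat J)\<^sup>2 * U) ((of_nat J)\<^sup>2 * V)"
    using K_nonzero one_minus_c_nonzero by (simp add: coarse_op_mode)
qed

lemma inv_point_jacobi_mode:
  "inv_into (fine_space J k) (point_jacobi J \<delta>\<^sub>0)
     (mode ((of_nat J)\<^sup>2 * p) ((of_nat J)\<^sup>2 * q) ((of_nat J)\<^sup>2 * r) ((of_nat J)\<^sup>2 * s)) =
   mode p (q / L) (r / L) s"
proof (rule inv_into_f_eq)
  show "inj_on (point_jacobi J \<delta>\<^sub>0) (fine_space J k)"
    using J_pos L_nonzero unfolding inj_on_def fine_space_eq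
    by (auto simp: point_jacobi_mode mode_inject)
  show "mode p (q / L) (r / L) s \<in> fine_space J k"
    unfolding fine_space_eq by blast
  show "point_jacobi J \<delta>\<^sub>0 (mode p (q / L) (r / L) s) =
      mode ((of_nat J)\<^sup>2 * p) ((of_nat J)\<^sup>2 * q) ((of_nat J)\<^sup>2 * r) ((of_nat J)\<^sup>2 * s)"
    using L_nonzero by (simp add: point_jacobi_mode)
qed

lemma mode_diff:
  "(\<lambda>j t. mode p q r s j t - a * mode p' q' r' s' j t) =
     mode (p - a * p') (q - a * q') (r - a * r') (s - a * s')"
  by (intro ext) (simp add: mode_def algebra_simps split: endpoint.split)

lemma smoothing_mode:
  "smoothing_op J \<delta>\<^sub>0 \<alpha> k (mode p q r s) =
     mode ((1 - of_real \<alpha> * (1 - c)) * p) ((1 - of_real \<alpha> * ((L - c) / L)) * q)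
          ((1 - of_real \<alpha> * ((L + c) / L)) * r) ((1 - of_real \<alpha> * (1 + c)) * s)"
  unfolding smoothing_op_def sipg_mode inv_point_jacobi_mode mode_diff mode_inject
  by (simp add: algebra_simps)

text \<open>The second coordinate, in the sense of \<open>coarse_mode\<close>, of the coarse
  solution for the residual of the wave. The first coordinate is simply
  \<open>(p - s) / 2\<close>.\<close>

definition odd_part :: "complex \<Rightarrow> complex \<Rightarrow> complex \<Rightarrow> complex \<Rightarrow> complex" where
  "odd_part p q r s = ((L - c) * q - (L + c) * r + \<tau> * ((1 - c) * p + (1 + c) * s))
                        / (2 * (L + 1 - c\<^sup>2))"

definition even_part :: "complex \<Rightarrow> complex \<Rightarrow> complex" where
  "even_part p s = ((1 - c) * p + (1 + c) * s) / 2"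

text \<open>Subtracting the prolongated first coarse coordinate \<open>(p - s) / 2\<close> replaces
  both node-continuous amplitudes \<open>p\<close> and \<open>s\<close> by the same number
  \<open>even_part p s\<close>. The prolongated second coordinate then changes both equally, so the
  first and last amplitudes of the result agree.\<close>

lemma coarse_correction_mode:
  "coarse_correction J \<delta>\<^sub>0 k (mode p q r s) =
     mode (even_part p s + \<tau> * odd_part p q r s) (q - odd_part p q r s)
          (r + odd_part p q r s) (even_part p s + \<tau> * odd_part p q r s)"
proof -
  define U V where "U = (p - s) / 2" and "V = odd_part p q r s"
  define U' where "U' = ((1 - c) * p - (1 + c) * s + c * ((1 - c) * p + (1 + c) * s)) / 4"
  define V' where "V' = ((L - c) * q - (L + c) * r + \<tau> * ((1 - c) * p + (1 + c) * s)) / 4"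
  have "restriction (sipg J \<delta>\<^sub>0 (mode p q r s)) =
      coarse_mode ((of_nat J)\<^sup>2 * U') ((of_nat J)\<^sup>2 * V')"
    unfolding sipg_mode restriction_mode coarse_mode_inject U'_def V'_def
    by (simp add: algebra_simps)
  moreover have "2 * U' / (1 - c\<^sup>2) = U"
  proof -
    have "2 * U' = (1 - c\<^sup>2) * U"
      by (simp add: U_def U'_def field_simps power2_eq_square)
    then show ?thesis
      using one_minus_c_nonzero by (simp add: field_simps)
  qed
  moreover have "2 * V' / (L + 1 - c\<^sup>2) = V"
  proof -
    have "2 * (x / 4) / y = x / (2 * y)" for x y :: complex
      by simp
    then show ?thesis
      unfolding V_def V'_def odd_part_def .
  qed
  ultimately have "inv_into (coarse_space J k) (coarse_op J \<delta>\<^sub>0)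
      (restriction (sipg J \<delta>\<^sub>0 (mode p q r s))) = coarse_mode U V"
    by (simp only: inv_coarse_op_mode)
  then have "coarse_correction J \<delta>\<^sub>0 k (mode p q r s) = (\<lambda>j t. mode p q r s j t -
      1 * mode ((1 + c) * U - \<tau> * V) V (- V) (- ((1 - c) * U) - \<tau> * V) j t)"
    unfolding coarse_correction_def by (simp add: prolongation_coarse_mode)
  then show ?thesis
    unfolding mode_diff V_def[symmetric]
    by (simp add: mode_inject even_part_def U_def field_simps)
qed

section \<open>Linearity of the error operator and its matrix\<close>

lemma fine_wave_inject:
  assumes "x \<in> carrier_vec 4" "y \<in> carrier_vec 4" "fine_wave J k x = fine_wave J k y"
  shows "x = y"
proof -
  have "x $ 0 + inverse e * x $ 1 = y $ 0 + inverse e * y $ 1"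
    "x $ 0 - inverse e * x $ 1 = y $ 0 - inverse e * y $ 1"
    "x $ 2 + inverse e * x $ 3 = y $ 2 + inverse e * y $ 3"
    "x $ 2 - inverse e * x $ 3 = y $ 2 - inverse e * y $ 3"
    using assms(3) unfolding fine_wave_eq_mode mode_inject
    by (simp_all only: divide_cancel_right) simp_all
  moreover have "u = u' \<and> v = v'" if "u + v = u' + v'" "u - v = u' - v'" for u v u' v' :: complex
    using that by (auto simp: complex_eq_iff)
  ultimately have "x $ 0 = y $ 0 \<and> inverse e * x $ 1 = inverse e * y $ 1"
    "x $ 2 = y $ 2 \<and> inverse e * x $ 3 = inverse e * y $ 3"
    by blast+
  then have "x $ i = y $ i" if "i \<in> {0, 1, 2, 3}" for i
    using that by auto
  moreover have "{..<4 :: nat} = {0, 1, 2, 3}"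
    by auto
  ultimately have "x $ i = y $ i" if "i < 4" for i
    using that by auto
  then show ?thesis
    using assms(1,2) by (intro eq_vecI) auto
qed

definition smooth_odd :: "real \<Rightarrow> complex \<Rightarrow> complex \<Rightarrow> complex \<Rightarrow> complex \<Rightarrow> complex" where
  "smooth_odd \<alpha> p q r s =
     odd_part ((1 - of_real \<alpha> * (1 - c)) * p) ((1 - of_real \<alpha> * ((L - c) / L)) * q)
              ((1 - of_real \<alpha> * ((L + c) / L)) * r) ((1 - of_real \<alpha> * (1 + c)) * s)"

definition smooth_even :: "real \<Rightarrow> complex \<Rightarrow> complex \<Rightarrow> complex" where
  "smooth_even \<alpha> p s =
     even_part ((1 - of_real \<alpha> * (1 - c)) * p) ((1 - of_real \<alpha> * (1 + c)) * s)"

lemma error_op_mode: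
  "error_op J \<delta>\<^sub>0 \<alpha> k (mode p q r s) =
     mode (smooth_even \<alpha> p s + \<tau> * smooth_odd \<alpha> p q r s)
          ((1 - of_real \<alpha> * ((L - c) / L)) * q - smooth_odd \<alpha> p q r s)
          ((1 - of_real \<alpha> * ((L + c) / L)) * r + smooth_odd \<alpha> p q r s)
          (smooth_even \<alpha> p s + \<tau> * smooth_odd \<alpha> p q r s)"
  unfolding error_op_def comp_def smoothing_mode coarse_correction_mode
    smooth_even_def smooth_odd_def ..

lemma smooth_odd_add:
  "smooth_odd \<alpha> (p + p') (q + q') (r + r') (s + s') =
     smooth_odd \<alpha> p q r s + smooth_odd \<alpha> p' q' r' s'"
  unfolding smooth_odd_def odd_part_def add_divide_distrib[symmetric]
  by (rule arg_cong2[where f = "(/)"]) (simp_all only: ring_distribs, simp)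

lemma smooth_odd_scale: "smooth_odd \<alpha> (a * p) (a * q) (a * r) (a * s) = a * smooth_odd \<alpha> p q r s"
  unfolding smooth_odd_def odd_part_def times_divide_eq_right
  by (rule arg_cong2[where f = "(/)"]) (simp_all add: algebra_simps)

lemma smooth_even_add: "smooth_even \<alpha> (p + p') (s + s') = smooth_even \<alpha> p s + smooth_even \<alpha> p' s'"
  by (simp add: smooth_even_def even_part_def field_simps)

lemma smooth_even_scale: "smooth_even \<alpha> (a * p) (a * s) = a * smooth_even \<alpha> p s"
  by (simp add: smooth_even_def even_part_def field_simps)

lemma mode_add:
  "(\<lambda>j t. mode p q r s j t + mode p' q' r' s' j t) =
     mode (p + p') (q + q') (r + r') (s + s')"
  by (intro ext) (simp add: mode_def algebra_simps split: endpoint.split)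

lemma mode_scale: "(\<lambda>j t. a * mode p q r s j t) = mode (a * p) (a * q) (a * r) (a * s)"
  by (intro ext) (simp add: mode_def algebra_simps split: endpoint.split)

text \<open>The operator contains \<open>inv_into\<close>, whose values are known only on images of
  the Fourier spaces; its additivity is therefore read off from the amplitudes of waves in the fine
  space.\<close>

lemma error_op_add:
  assumes "v \<in> fine_space J k" "w \<in> fine_space J k"
  shows "error_op J \<delta>\<^sub>0 \<alpha> k (\<lambda>j t. v j t + w j t) =
    (\<lambda>j t. error_op J \<delta>\<^sub>0 \<alpha> k v j t + error_op J \<delta>\<^sub>0 \<alpha> k w j t)"
proof -
  obtain p q r s p' q' r' s' where v: "v = mode p q r s" and w: "w = mode p' q' r' s'"
    using assms unfolding fine_space_eq by blast
  show ?thesis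
    unfolding v w mode_add error_op_mode smooth_odd_add smooth_even_add
    by (simp add: mode_inject algebra_simps add_divide_distrib diff_divide_distrib)
qed

lemma error_op_scale:
  assumes "v \<in> fine_space J k"
  shows "error_op J \<delta>\<^sub>0 \<alpha> k (\<lambda>j t. a * v j t) = (\<lambda>j t. a * error_op J \<delta>\<^sub>0 \<alpha> k v j t)"
proof -
  obtain p q r s where v: "v = mode p q r s"
    using assms unfolding fine_space_eq by blast
  show ?thesis
    unfolding v mode_scale error_op_mode smooth_odd_scale smooth_even_scale
    by (simp add: mode_inject algebra_simps)
qed

lemma error_op_fine_space: "v \<in> fine_space J k \<Longrightarrow> error_op J \<delta>\<^sub>0 \<alpha> k v \<in> fine_space J k"
  unfolding fine_space_eq using error_op_mode by blast

lemma fine_wave_expand: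
  "fine_wave J k x = (\<lambda>j t. \<Sum>i<4. x $ i * fine_wave J k (unit_vec 4 i) j t)"
  by (intro ext) (simp add: fine_wave_def numeral_eq_Suc lessThan_Suc algebra_simps split: endpoint.split)

text \<open>Membership of the partial sums is carried through the induction because
  \<open>error_op_add\<close> applies only inside the fine space.\<close>

lemma sum_fine_space:
  fixes f :: "nat \<Rightarrow> grid_fun"
  assumes "\<And>i. f i \<in> fine_space J k"
  shows "(\<lambda>j t. \<Sum>i<n. f i j t) \<in> fine_space J k
       \<and> error_op J \<delta>\<^sub>0 \<alpha> k (\<lambda>j t. \<Sum>i<n. f i j t) = (\<lambda>j t. \<Sum>i<n. error_op J \<delta>\<^sub>0 \<alpha> k (f i) j t)"
proof (induction n)
  case 0
  have 0: "(\<lambda>j t. 0) = mode 0 0 0 0"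
    by (intro ext) (simp add: mode_def split: endpoint.split)
  show ?case
    unfolding lessThan_0 sum.empty 0 error_op_mode fine_space_eq
    by (auto simp: smooth_even_def smooth_odd_def even_part_def odd_part_def)
next
  case (Suc n)
  have "(\<lambda>j t. v j t + w j t) \<in> fine_space J k"
    if "v \<in> fine_space J k" "w \<in> fine_space J k" for v w
    using that unfolding fine_space_eq using mode_add by blast
  then show ?case
    using Suc assms[of n] error_op_add[of "\<lambda>j t. \<Sum>i<n. f i j t" "f n"] by (simp add: add_ac)
qed

text \<open>The columns are coordinates of the images of the unit waves. These images stay in the
  fine space, so \<open>inv_into\<close> returns true preimages, and linearity extends the relation
  to all vectors.\<close>

lemma fine_wave_error_symbol:
  assumes "x \<in> carrier_vec 4"
  shows "fine_wave J k (error_symbol J \<delta>\<^sub>0 \<alpha> k *\<^sub>v x) = error_op J \<delta>\<^sub>0 \<alpha> k (fine_wave J k x)"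
proof -
  define col where "col i = inv_into (carrier_vec 4) (fine_wave J k)
       (error_op J \<delta>\<^sub>0 \<alpha> k (fine_wave J k (unit_vec 4 i)))" for i
  have wave: "fine_wave J k y \<in> fine_space J k" if "y \<in> carrier_vec 4" for y
    using that unfolding fine_space_def by blast
  have scale: "(\<lambda>j t. a * v j t) \<in> fine_space J k" if "v \<in> fine_space J k" for a v
    using that unfolding fine_space_eq using mode_scale by blast
  have col: "fine_wave J k (col i) = error_op J \<delta>\<^sub>0 \<alpha> k (fine_wave J k (unit_vec 4 i))" for i
    unfolding col_def
    by (rule f_inv_into_f) (use error_op_fine_space[OF wave] in \<open>simp add: fine_space_def\<close>)
  have entry: "(error_symbol J \<delta>\<^sub>0 \<alpha> k *\<^sub>v x) $ r = (\<Sum>i<4. x $ i * col i $ r)" if "r < 4" for r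
    using that assms
    by (auto simp: error_symbol_def col_def scalar_prod_def lessThan_atLeast0 mult_ac intro!: sum.cong)
  have "fine_wave J k (error_symbol J \<delta>\<^sub>0 \<alpha> k *\<^sub>v x) =
      (\<lambda>j t. \<Sum>i<4. x $ i * fine_wave J k (col i) j t)"
    by (intro ext) (simp add: fine_wave_def entry numeral_eq_Suc lessThan_Suc algebra_simps
        split: endpoint.split)
  also have "\<dots> = (\<lambda>j t. \<Sum>i<4. error_op J \<delta>\<^sub>0 \<alpha> k (\<lambda>j t. x $ i * fine_wave J k (unit_vec 4 i) j t) j t)"
    by (simp add: col error_op_scale wave)
  also have "\<dots> = error_op J \<delta>\<^sub>0 \<alpha> k (fine_wave J k x)"
    unfolding fine_wave_expand[of x]
    by (intro sum_fine_space[THEN conjunct2, symmetric] scale wave) simp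
  finally show ?thesis .
qed

text \<open>Since \<open>fine_wave\<close> is a linear bijection onto the fine space that
  intertwines the matrix with \<open>error_op\<close>, eigenvectors correspond to eigenfunctions,
  which can be described by their amplitudes.\<close>

lemma eigenvalue_error_symbol_iff:
  "eigenvalue (error_symbol J \<delta>\<^sub>0 \<alpha> k) l \<longleftrightarrow>
     (\<exists>p q r s. (p, q, r, s) \<noteq> (0, 0, 0, 0) \<and>
        error_op J \<delta>\<^sub>0 \<alpha> k (mode p q r s) = mode (l * p) (l * q) (l * r) (l * s))"
proof
  assume "eigenvalue (error_symbol J \<delta>\<^sub>0 \<alpha> k) l"
  then obtain x where x: "x \<in> carrier_vec 4" "x \<noteq> 0\<^sub>v 4" "error_symbol J \<delta>\<^sub>0 \<alpha> k *\<^sub>v x = l \<cdot>\<^sub>v x"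
    unfolding eigenvalue_def eigenvector_def by (auto simp: error_symbol_def)
  obtain p q r s where m: "fine_wave J k x = mode p q r s"
    using fine_wave_eq_mode by blast
  have l: "fine_wave J k (l \<cdot>\<^sub>v x) = (\<lambda>j t. l * fine_wave J k x j t)"
    using x(1) by (intro ext) (simp add: fine_wave_def algebra_simps split: endpoint.split)
  have "(p, q, r, s) \<noteq> (0, 0, 0, 0)"
  proof
    assume "(p, q, r, s) = (0, 0, 0, 0)"
    then have "fine_wave J k x = fine_wave J k (0\<^sub>v 4)"
      unfolding m by (simp add: fine_wave_eq_mode)
    then show False
      using fine_wave_inject[OF x(1)] x(2) by simp
  qed
  moreover have "error_op J \<delta>\<^sub>0 \<alpha> k (mode p q r s) = mode (l * p) (l * q) (l * r) (l * s)"
    using fine_wave_error_symbol[OF x(1), of \<alpha>] unfolding x(3) l m mode_scale by simp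
  ultimately show "\<exists>p q r s. (p, q, r, s) \<noteq> (0, 0, 0, 0) \<and>
        error_op J \<delta>\<^sub>0 \<alpha> k (mode p q r s) = mode (l * p) (l * q) (l * r) (l * s)"
    by blast
next
  assume "\<exists>p q r s. (p, q, r, s) \<noteq> (0, 0, 0, 0) \<and>
        error_op J \<delta>\<^sub>0 \<alpha> k (mode p q r s) = mode (l * p) (l * q) (l * r) (l * s)"
  then obtain p q r s where nz: "(p, q, r, s) \<noteq> (0, 0, 0, 0)"
    and eq: "error_op J \<delta>\<^sub>0 \<alpha> k (mode p q r s) = mode (l * p) (l * q) (l * r) (l * s)"
    by blast
  have "mode p q r s \<in> fine_space J k"
    unfolding fine_space_eq by blast
  then obtain x where x: "x \<in> carrier_vec 4" and m: "fine_wave J k x = mode p q r s"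
    unfolding fine_space_def by auto
  have "x \<noteq> 0\<^sub>v 4"
  proof
    assume "x = 0\<^sub>v 4"
    then have "mode p q r s = mode 0 0 0 0"
      unfolding m[symmetric] by (simp add: fine_wave_eq_mode)
    then show False
      using nz by (simp add: mode_inject)
  qed
  moreover have "fine_wave J k (l \<cdot>\<^sub>v x) = (\<lambda>j t. l * fine_wave J k x j t)"
    using x by (intro ext) (simp add: fine_wave_def algebra_simps split: endpoint.split)
  then have "fine_wave J k (error_symbol J \<delta>\<^sub>0 \<alpha> k *\<^sub>v x) = fine_wave J k (l \<cdot>\<^sub>v x)"
    unfolding fine_wave_error_symbol[OF x] m eq mode_scale by simp
  then have "error_symbol J \<delta>\<^sub>0 \<alpha> k *\<^sub>v x = l \<cdot>\<^sub>v x"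
    using x by (intro fine_wave_inject carrier_vecI) (simp_all add: error_symbol_def)
  ultimately show "eigenvalue (error_symbol J \<delta>\<^sub>0 \<alpha> k) l"
    using x unfolding eigenvalue_def eigenvector_def by (auto simp: error_symbol_def)
qed

section \<open>Eigenvalues of the error operator\<close>

lemma double_K_nonzero: "2 * (L + 1 - c\<^sup>2) \<noteq> 0"
  by (metis K_nonzero mult_eq_0_iff zero_neq_numeral)

lemma odd_part_eq:
  "2 * (L + 1 - c\<^sup>2) * odd_part p q r s =
     (L - c) * q - (L + c) * r + \<tau> * ((1 - c) * p + (1 + c) * s)"
  unfolding odd_part_def times_divide_eq_right
  by (rule nonzero_mult_div_cancel_left) (rule double_K_nonzero)

text \<open>An eigenfunction for a nonzero eigenvalue lies in the range of the coarse correction,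
  which forces \<open>s = p\<close> and a vanishing restricted residual. What remains is a
  homogeneous system in \<open>p\<close>, \<open>q\<close>, \<open>r\<close>, singular exactly when
  the quadratic vanishes.\<close>

lemma nonzero_eigenvalue:
  assumes "eigenvalue (error_symbol J \<delta>\<^sub>0 \<alpha> k) l" and "l \<noteq> 0" and "\<alpha> \<noteq> 0"
  obtains \<mu> where "l = 1 - of_real \<alpha> * \<mu>" and "symbol_poly L (c\<^sup>2) \<mu> = 0"
proof -
  obtain p q r s where nz: "(p, q, r, s) \<noteq> (0, 0, 0, 0)"
    and eq: "error_op J \<delta>\<^sub>0 \<alpha> k (mode p q r s) = mode (l * p) (l * q) (l * r) (l * s)"
    using assms(1) unfolding eigenvalue_error_symbol_iff by blast
  define V where "V = smooth_odd \<alpha> p q r s"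
  define a where "a = complex_of_real \<alpha>"
  define \<mu> where "\<mu> = (1 - l) / a"
  have a: "a \<noteq> 0" and l: "l = 1 - a * \<mu>"
    using assms(3) by (simp_all add: a_def \<mu>_def)
  have E: "smooth_even \<alpha> p s + \<tau> * V = l * p" "(1 - a * ((L - c) / L)) * q - V = l * q"
    "(1 - a * ((L + c) / L)) * r + V = l * r" "smooth_even \<alpha> p s + \<tau> * V = l * s"
    using eq unfolding error_op_mode mode_inject V_def a_def by blast+
  have "l * p = l * s"
    by (rule trans[OF E(1)[symmetric] E(4)])
  then have s: "s = p"
    using assms(2) by simp
  have even: "smooth_even \<alpha> p s = (1 - a * (1 + c\<^sup>2)) * p"
    unfolding s smooth_even_def even_part_def a_def by (simp add: field_simps power2_eq_square)
  have q: "(1 - a * ((L - c) / L)) * q = l * q + V" and r: "(1 - a * ((L + c) / L)) * r = l * r - V"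
    using E(2,3) by (simp_all add: algebra_simps)
  \<comment> \<open>The eigenvalue equations are inserted into the formula for \<open>V\<close>. As
    \<open>\<tau> * \<tau> = c * c - 1\<close>, all multiples of \<open>V\<close> cancel, leaving
    \<open>l\<close> times the second component of the restricted residual.\<close>
  have "2 * (L + 1 - c\<^sup>2) * V = (L - c) * ((1 - a * ((L - c) / L)) * q)
      - (L + c) * ((1 - a * ((L + c) / L)) * r)
      + \<tau> * ((1 - c) * ((1 - a * (1 - c)) * p) + (1 + c) * ((1 - a * (1 + c)) * s))"
    unfolding V_def smooth_odd_def a_def by (rule odd_part_eq)
  also have "\<dots> = (L - c) * (l * q + V) - (L + c) * (l * r - V) + \<tau> * (2 * smooth_even \<alpha> p s)"
    unfolding a_def[symmetric] q r smooth_even_def even_part_def by simp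
  also have "smooth_even \<alpha> p s = l * p - \<tau> * V"
    using E(1) by (simp add: algebra_simps)
  finally have "2 * (L + 1 - c * c) * V + 2 * (\<tau> * \<tau>) * V
      = (L - c) * (l * q + V) - (L + c) * (l * r - V) + 2 * \<tau> * l * p"
    by (simp add: algebra_simps power2_eq_square)
  then have "l * ((L - c) * q - (L + c) * r + 2 * \<tau> * p) = 0"
    unfolding tau_squared by (simp add: algebra_simps)
  then have 3: "(L - c) * q - (L + c) * r + 2 * \<tau> * p = 0"
    using assms(2) by simp
  \<comment> \<open>Both sign-changing amplitudes determine \<open>V\<close>; equating the two
    expressions yields the second equation of the system, and comparison with the continuous
    amplitude yields the first.\<close>
  have VL: "L * V = a * (\<mu> * L - L + c) * q" "L * V = - (a * (\<mu> * L - L - c) * r)"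
    using E(2,3) L_nonzero unfolding l by (simp_all add: field_simps)
  have "a * ((\<mu> * L - L + c) * q + (\<mu> * L - L - c) * r)
      = a * (\<mu> * L - L + c) * q + a * (\<mu> * L - L - c) * r"
    by (simp add: algebra_simps)
  also have "\<dots> = 0"
    unfolding VL(1)[symmetric] VL(2) by simp
  finally have "a * ((\<mu> * L - L + c) * q + (\<mu> * L - L - c) * r) = 0" .
  then have 2: "(\<mu> * L - L + c) * q + (\<mu> * L - L - c) * r = 0"
    using a by simp
  have "\<tau> * V = a * (1 + c\<^sup>2 - \<mu>) * p"
    using E(1) unfolding even l by (simp add: algebra_simps)
  then have "L * (a * (1 + c\<^sup>2 - \<mu>) * p) = \<tau> * (L * V)"
    by (simp add: mult_ac)
  then have "a * (\<tau> * (\<mu> * L - L + c) * q) = a * (L * (1 + c\<^sup>2 - \<mu>) * p)"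
    unfolding VL(1) by (simp only: mult_ac)
  then have 1: "\<tau> * (\<mu> * L - L + c) * q = L * (1 + c\<^sup>2 - \<mu>) * p"
    using a by simp
  \<comment> \<open>This determinant is -2 times the quadratic.\<close>
  have "L * (1 + c\<^sup>2 - \<mu>) * ((\<mu> * L - L + c) * (L + c) + (\<mu> * L - L - c) * (L - c))
      + 2 * \<tau>\<^sup>2 * (\<mu> * L - L + c) * (\<mu> * L - L - c) = 0"
    using nz unfolding s by (intro singular_system[OF 1 2 3]) auto
  then have "2 * symbol_poly L (c\<^sup>2) \<mu> = 0"
    unfolding power2_eq_square[of \<tau>] tau_squared symbol_poly_def
    by (simp add: algebra_simps power2_eq_square power3_eq_cube)
  then show ?thesis
    using that[of \<mu>] l unfolding a_def by simp
qed

text \<open>For the converse of \<open>nonzero_eigenvalue\<close>, a null vector of the same system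
  is written down explicitly.\<close>

lemma eigenvalue_of_root:
  assumes root: "symbol_poly L (c\<^sup>2) \<mu> = 0" and "c \<noteq> 0"
  shows "eigenvalue (error_symbol J \<delta>\<^sub>0 \<alpha> k) (1 - of_real \<alpha> * \<mu>)"
proof -
  \<comment> \<open>\<open>q\<close> and \<open>r\<close> solve the second equation of the system by
    cross-multiplication, \<open>p\<close> is then determined by the third, and the first holds
    because \<open>\<mu>\<close> is a root.\<close>
  define p where "p = L\<^sup>2 * (\<mu> - 1) + c\<^sup>2"
  define q where "q = \<tau> * (L + c - \<mu> * L)"
  define r where "r = \<tau> * (\<mu> * L - L + c)"
  define a where "a = complex_of_real \<alpha>"
  define V where "V = a * (\<mu> * L - L + c) * q / L"
  have q: "(1 - a * ((L - c) / L)) * q = (1 - a * \<mu>) * q + V"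
    using L_nonzero by (simp add: V_def field_simps)
  have r: "(1 - a * ((L + c) / L)) * r = (1 - a * \<mu>) * r - V"
    using L_nonzero by (simp add: V_def q_def r_def field_simps)
  have 3: "(L - c) * q - (L + c) * r + 2 * \<tau> * p = 0"
    by (simp add: p_def q_def r_def algebra_simps power2_eq_square)
  have p_eq: "L * (1 + c\<^sup>2 - \<mu>) * p + (c\<^sup>2 - 1) * (L\<^sup>2 * (\<mu> - 1)\<^sup>2 - c\<^sup>2) = 0"
    using symbol_poly_alt[of L "c\<^sup>2" \<mu>] root by (simp add: p_def)
  have q_eq: "\<tau> * (\<mu> * L - L + c) * q = - ((c\<^sup>2 - 1) * (L\<^sup>2 * (\<mu> - 1)\<^sup>2 - c\<^sup>2))"
  proof -
    have "\<tau> * (\<mu> * L - L + c) * q = (\<tau> * \<tau>) * (\<mu> * L - L + c) * (L + c - \<mu> * L)"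
      by (simp add: q_def mult_ac)
    then show ?thesis
      unfolding tau_squared by (simp add: algebra_simps power2_eq_square)
  qed
  have "L * (1 + c\<^sup>2 - \<mu>) * p = \<tau> * (\<mu> * L - L + c) * q"
    unfolding q_eq eq_neg_iff_add_eq_0 by (rule p_eq)
  note row = this
  have LV: "L * V = a * (\<mu> * L - L + c) * q"
    using L_nonzero by (simp add: V_def)
  have "L * (a * (1 + c\<^sup>2 - \<mu>) * p) = a * (L * (1 + c\<^sup>2 - \<mu>) * p)"
    by (simp only: mult_ac)
  also have "\<dots> = \<tau> * (L * V)"
    unfolding row LV by (simp only: mult_ac)
  also have "\<dots> = L * (\<tau> * V)"
    by (simp only: mult_ac)
  finally have "L * (a * (1 + c\<^sup>2 - \<mu>) * p) = L * (\<tau> * V)" .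
  then have "a * (1 + c\<^sup>2 - \<mu>) * p = \<tau> * V"
    using L_nonzero by simp
  then have even: "smooth_even \<alpha> p p = (1 - a * \<mu>) * p - \<tau> * V"
    unfolding smooth_even_def even_part_def a_def[symmetric]
    by (simp add: field_simps power2_eq_square)
  have "2 * (L + 1 - c\<^sup>2) * smooth_odd \<alpha> p q r p =
      (L - c) * ((1 - a * \<mu>) * q + V) - (L + c) * ((1 - a * \<mu>) * r - V)
      + \<tau> * (2 * smooth_even \<alpha> p p)"
    unfolding smooth_odd_def odd_part_eq a_def[symmetric] q r smooth_even_def even_part_def by simp
  also have "\<dots> = (1 - a * \<mu>) * ((L - c) * q - (L + c) * r + 2 * \<tau> * p) + 2 * (L - \<tau> * \<tau>) * V"
    unfolding even by (simp add: algebra_simps)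
  also have "\<dots> = 2 * (L + 1 - c\<^sup>2) * V"
    unfolding 3 tau_squared by (simp add: power2_eq_square)
  finally have odd: "smooth_odd \<alpha> p q r p = V"
    unfolding mult_left_cancel[OF double_K_nonzero] .
  \<comment> \<open>The sum of \<open>q\<close> and \<open>r\<close> is
    \<open>2 * c * \<tau>\<close>, so a nonzero \<open>c\<close> keeps the vector from
    vanishing.\<close>
  have "(p, q, r, p) \<noteq> (0, 0, 0, 0)"
  proof
    assume "(p, q, r, p) = (0, 0, 0, 0)"
    then have "q + r = 0" by simp
    then have "\<tau> * (2 * c) = 0"
      by (simp add: q_def r_def algebra_simps)
    then show False
      using tau_nonzero \<open>c \<noteq> 0\<close> by simp
  qed
  moreover have "error_op J \<delta>\<^sub>0 \<alpha> k (mode p q r p) =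
      mode ((1 - a * \<mu>) * p) ((1 - a * \<mu>) * q) ((1 - a * \<mu>) * r) ((1 - a * \<mu>) * p)"
    unfolding error_op_mode odd even a_def[symmetric] q r by simp
  ultimately show ?thesis
    unfolding eigenvalue_error_symbol_iff a_def by blast
qed

section \<open>Spectral radius at one frequency\<close>

lemma error_symbol_carrier: "error_symbol J \<delta>\<^sub>0 \<alpha> k \<in> carrier_mat 4 4"
  by (simp add: error_symbol_def)

lemma c_squared: "c\<^sup>2 = of_real ((cos \<theta>)\<^sup>2)"
  by (simp add: c_def)

text \<open>The radius is attained by an eigenvalue. If nonzero, it is
  \<open>1 - \<alpha> * u\<close> with \<open>u\<close> between the two extreme roots, and the
  absolute value of an affine function is largest at an endpoint. A nonzero \<alpha> is required to
  recover the root from the eigenvalue.\<close>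

lemma spectral_radius_le:
  assumes "\<alpha> \<noteq> 0"
  shows "spectral_radius (error_symbol J \<delta>\<^sub>0 \<alpha> k)
    \<le> max \<bar>1 - \<alpha> * (1 - 1 / (2 * \<delta>\<^sub>0 - 1)\<^sup>2)\<bar> \<bar>1 - \<alpha> * 2\<bar>"
proof -
  define m where "m = 1 - 1 / (2 * \<delta>\<^sub>0 - 1)\<^sup>2"
  obtain l where l: "eigenvalue (error_symbol J \<delta>\<^sub>0 \<alpha> k) l"
    and radius: "spectral_radius (error_symbol J \<delta>\<^sub>0 \<alpha> k) = cmod l"
    using spectral_radius_mem_max(1)[OF error_symbol_carrier] by (auto simp: spectrum_def)
  show ?thesis
  proof (cases "l = 0")
    case False
    obtain \<mu> where l_eq: "l = 1 - of_real \<alpha> * \<mu>" and root: "symbol_poly L (c\<^sup>2) \<mu> = 0"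
      using nonzero_eigenvalue[OF l False assms] .
    have cos: "0 \<le> (cos \<theta>)\<^sup>2" "(cos \<theta>)\<^sup>2 \<le> 1"
      by (simp_all add: abs_square_le_1)
    have "1 \<le> 2 * \<delta>\<^sub>0 - 1"
      using penalty_ge_1 by simp
    then obtain u where u: "\<mu> = of_real u" "m \<le> u" "u \<le> 2"
      using symbol_poly_root_range[OF _ cos root[unfolded L_def c_squared]] unfolding m_def by auto
    have "cmod l = \<bar>1 - \<alpha> * u\<bar>"
      unfolding l_eq u by (metis norm_of_real of_real_1 of_real_diff of_real_mult)
    moreover have "\<alpha> * m \<le> \<alpha> * u \<and> \<alpha> * u \<le> \<alpha> * 2 \<or> \<alpha> * 2 \<le> \<alpha> * u \<and> \<alpha> * u \<le> \<alpha> * m"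
      using u(2,3) by (cases "\<alpha> \<ge> 0") (auto intro: mult_left_mono mult_left_mono_neg)
    ultimately show ?thesis
      unfolding radius m_def[symmetric] by linarith
  qed (auto simp: radius)
qed

lemma spectral_radius_ge:
  assumes "symbol_poly (2 * \<delta>\<^sub>0 - 1) ((cos \<theta>)\<^sup>2) u = 0" and "cos \<theta> \<noteq> 0"
  shows "\<bar>1 - \<alpha> * u\<bar> \<le> spectral_radius (error_symbol J \<delta>\<^sub>0 \<alpha> k)"
proof -
  have "symbol_poly L (c\<^sup>2) (of_real u) = 0"
    unfolding L_def c_squared symbol_poly_of_real assms(1) by simp
  moreover have "c \<noteq> 0"
    using assms(2) by (simp add: c_def)
  ultimately have "eigenvalue (error_symbol J \<delta>\<^sub>0 \<alpha> k) (1 - of_real \<alpha> * of_real u)"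
    by (rule eigenvalue_of_root)
  then have "cmod (1 - of_real \<alpha> * of_real u) \<le> spectral_radius (error_symbol J \<delta>\<^sub>0 \<alpha> k)"
    using spectral_radius_mem_max(2)[OF error_symbol_carrier] by (auto simp: spectrum_def)
  then show ?thesis
    by (metis norm_of_real of_real_1 of_real_diff of_real_mult)
qed

end

section \<open>Bounds for the convergence factor\<close>

lemma conv_factor_le:
  assumes "J > 0" and "\<delta>\<^sub>0 \<ge> 1" and "\<alpha> \<noteq> 0"
  shows "conv_factor J \<delta>\<^sub>0 \<alpha> \<le> ereal (max \<bar>1 - \<alpha> * (1 - 1 / (2 * \<delta>\<^sub>0 - 1)\<^sup>2)\<bar> \<bar>1 - \<alpha> * 2\<bar>)"
  unfolding conv_factor_def
proof (rule SUP_least)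
  fix k assume "k \<in> {- real J / 2..real J / 2} - {0, real J / 2, - real J / 2}"
  then interpret fourier_mode J \<delta>\<^sub>0 k
    using assms by unfold_locales
  show "ereal (spectral_radius (error_symbol J \<delta>\<^sub>0 \<alpha> k))
      \<le> ereal (max \<bar>1 - \<alpha> * (1 - 1 / (2 * \<delta>\<^sub>0 - 1)\<^sup>2)\<bar> \<bar>1 - \<alpha> * 2\<bar>)"
    using spectral_radius_le[OF assms(3)] by (simp only: ereal_less_eq)
qed

text \<open>At a point \<open>y\<close> strictly between the limit roots the limit polynomial is
  negative, and by continuity so is the polynomial for small positive \<open>k\<close>. At
  \<open>w\<close> it is nonnegative, so the intermediate value theorem gives a root between
  \<open>y\<close> and \<open>w\<close>.\<close>

lemma symbol_poly_root_near:
  fixes L w \<epsilon> :: real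
  assumes "J > 0" and L: "L \<ge> 1" and w: "w \<in> {1 - 1 / L\<^sup>2, 2}" and "\<epsilon> > 0"
  obtains k u where "k \<in> {0 <..< real J / 2}" and "cos (2 * pi * k / real J) \<noteq> 0"
    and "symbol_poly L ((cos (2 * pi * k / real J))\<^sup>2) u = 0" and "\<bar>u - w\<bar> \<le> \<epsilon>"
proof -
  define m where "m = 1 - 1 / L\<^sup>2"
  have m: "m < 1"
    using L by (simp add: m_def)
  have "\<exists>y. m < y \<and> y < 2 \<and> \<bar>y - w\<bar> \<le> \<epsilon> \<and> (w = 2 \<or> w = m)"
  proof (cases "w = 2")
    case True
    then show ?thesis
      using m \<open>\<epsilon> > 0\<close> by (intro exI[of _ "max 1 (2 - \<epsilon>)"]) auto
  next
    case False
    then show ?thesis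
      using w m \<open>\<epsilon> > 0\<close> by (intro exI[of _ "min 1 (m + \<epsilon>)"]) (auto simp: m_def[symmetric])
  qed
  then obtain y where y: "m < y" "y < 2" "\<bar>y - w\<bar> \<le> \<epsilon>" "w = 2 \<or> w = m"
    by blast
  have "L^3 * ((y - 2) * (y - m)) < 0"
    using y L by (intro mult_pos_neg mult_neg_pos) auto
  then have neg: "symbol_poly L 1 y < 0"
    using L by (simp add: symbol_poly_limit m_def)
  have "((\<lambda>k. symbol_poly L ((cos (2 * pi * k / real J))\<^sup>2) y) \<longlongrightarrow> symbol_poly L ((cos (2 * pi * 0 / real J))\<^sup>2) y)
      (at_right 0)"
    unfolding symbol_poly_def by (intro tendsto_intros) (use \<open>J > 0\<close> in auto)
  then have "((\<lambda>k. symbol_poly L ((cos (2 * pi * k / real J))\<^sup>2) y) \<longlongrightarrow> symbol_poly L 1 y) (at_right 0)"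
    by simp
  then have 1: "\<forall>\<^sub>F k in at_right 0. symbol_poly L ((cos (2 * pi * k / real J))\<^sup>2) y < 0"
    using neg by (rule order_tendstoD)
  have "((\<lambda>k. cos (2 * pi * k / real J)) \<longlongrightarrow> cos (2 * pi * 0 / real J)) (at_right 0)"
    by (intro tendsto_intros) (use \<open>J > 0\<close> in auto)
  then have 2: "\<forall>\<^sub>F k in at_right 0. cos (2 * pi * k / real J) > 0"
    by (rule order_tendstoD) simp
  have 3: "\<forall>\<^sub>F k in at_right 0. k \<in> {0 <..< real J / 2}"
    using \<open>J > 0\<close> by (intro eventually_at_right_real) simp
  obtain k where k: "k \<in> {0 <..< real J / 2}" "cos (2 * pi * k / real J) > 0"
      "symbol_poly L ((cos (2 * pi * k / real J))\<^sup>2) y < 0"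
    using eventually_happens'[OF _ eventually_conj[OF 3 eventually_conj[OF 2 1]]] by auto
  define x where "x = (cos (2 * pi * k / real J))\<^sup>2"
  have x: "0 \<le> x" "x \<le> 1"
    by (simp_all add: x_def abs_square_le_1)
  have cont: "continuous_on A (symbol_poly L x)" for A
    unfolding symbol_poly_def by (intro continuous_intros)
  have "\<exists>u. symbol_poly L x u = 0 \<and> \<bar>u - w\<bar> \<le> \<epsilon>"
  proof (cases "w = 2")
    case True
    then show ?thesis
      using IVT'[of "symbol_poly L x" y 0 2] cont symbol_poly_at_2[OF L x] k(3) y(2,3)
      by (force simp: x_def)
  next
    case False
    then show ?thesis
      using IVT2'[of "symbol_poly L x" y 0 m] cont symbol_poly_at_min[OF L x] k(3) y(1,3,4)
      by (force simp: x_def m_def)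
  qed
  then show ?thesis
    using that k unfolding x_def by auto
qed

text \<open>The bound is a limit of spectral radii as the frequency tends to 0, so every
  \<open>r\<close> strictly below it is reached at some admissible frequency.\<close>

lemma conv_factor_ge:
  assumes "J > 0" and "\<delta>\<^sub>0 \<ge> 1" and w: "w \<in> {1 - 1 / (2 * \<delta>\<^sub>0 - 1)\<^sup>2, 2}"
  shows "ereal \<bar>1 - \<alpha> * w\<bar> \<le> conv_factor J \<delta>\<^sub>0 \<alpha>"
proof (rule ccontr)
  assume "\<not> ?thesis"
  then obtain r where r: "conv_factor J \<delta>\<^sub>0 \<alpha> < ereal r" "r < \<bar>1 - \<alpha> * w\<bar>"
    unfolding not_le by (auto dest: ereal_dense2)
  \<comment> \<open>Moving \<open>w\<close> by this amount changes \<open>\<alpha> * w\<close> by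
    less than the gap to \<open>r\<close>; the added 1 avoids division by zero for vanishing
    \<alpha>.\<close>
  define \<epsilon> where "\<epsilon> = (\<bar>1 - \<alpha> * w\<bar> - r) / (\<bar>\<alpha>\<bar> + 1)"
  have \<epsilon>: "\<epsilon> > 0" "(\<bar>\<alpha>\<bar> + 1) * \<epsilon> = \<bar>1 - \<alpha> * w\<bar> - r"
    using r(2) by (auto simp: \<epsilon>_def)
  have "2 * \<delta>\<^sub>0 - 1 \<ge> 1"
    using assms(2) by simp
  from symbol_poly_root_near[OF assms(1) this w \<epsilon>(1)] obtain k u
    where k: "k \<in> {0 <..< real J / 2}" "cos (2 * pi * k / real J) \<noteq> 0"
      and u: "symbol_poly (2 * \<delta>\<^sub>0 - 1) ((cos (2 * pi * k / real J))\<^sup>2) u = 0" "\<bar>u - w\<bar> \<le> \<epsilon>"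
    by blast
  have dom: "k \<in> {- real J / 2..real J / 2} - {0, real J / 2, - real J / 2}"
    using k(1) by auto
  then interpret fourier_mode J \<delta>\<^sub>0 k
    using assms by unfold_locales
  have "\<bar>1 - \<alpha> * w\<bar> \<le> \<bar>1 - \<alpha> * u\<bar> + \<bar>\<alpha> * (u - w)\<bar>"
    by (simp add: algebra_simps)
  moreover have "\<bar>\<alpha> * (u - w)\<bar> \<le> \<bar>\<alpha>\<bar> * \<epsilon>"
    unfolding abs_mult using u(2) by (intro mult_left_mono) auto
  ultimately have "r \<le> \<bar>1 - \<alpha> * u\<bar>"
    using \<epsilon> by (simp add: algebra_simps)
  also have "\<dots> \<le> spectral_radius (error_symbol J \<delta>\<^sub>0 \<alpha> k)"
    using u(1) k(2) by (intro spectral_radius_ge) (simp_all add: \<theta>_def)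
  finally have "ereal r \<le> ereal (spectral_radius (error_symbol J \<delta>\<^sub>0 \<alpha> k))"
    by simp
  also have "\<dots> \<le> conv_factor J \<delta>\<^sub>0 \<alpha>"
    unfolding conv_factor_def using dom by (rule SUP_upper)
  finally show False
    using r(1) by simp
qed

section \<open>The optimal relaxation parameter\<close>

theorem theorem5p1:
  fixes J :: nat and \<delta>\<^sub>0 :: real
  assumes "even J" and "J > 0" and "\<delta>\<^sub>0 \<ge> 1"
  shows "is_arg_min (conv_factor J \<delta>\<^sub>0) (\<lambda>_. True)
           ((2 * \<delta>\<^sub>0 - 1)\<^sup>2 / (6 * \<delta>\<^sub>0\<^sup>2 - 6 * \<delta>\<^sub>0 + 1)) \<and>
         (\<delta>\<^sub>0 > 1 \<longrightarrow>
           (\<forall>\<alpha>. is_arg_min (conv_factor J \<delta>\<^sub>0) (\<lambda>_. True) \<alpha> \<longrightarrow>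
                \<alpha> = (2 * \<delta>\<^sub>0 - 1)\<^sup>2 / (6 * \<delta>\<^sub>0\<^sup>2 - 6 * \<delta>\<^sub>0 + 1)))"
proof -
  define m where "m = 1 - 1 / (2 * \<delta>\<^sub>0 - 1)\<^sup>2"
  \<comment> \<open>Here the decreasing branch \<open>1 - \<alpha> * m\<close> meets the increasing
    branch \<open>\<alpha> * 2 - 1\<close>; \<rho> is their common value.\<close>
  define \<omega> where "\<omega> = 2 / (2 + m)"
  define \<rho> where "\<rho> = (2 - m) / (2 + m)"
  have L: "2 * \<delta>\<^sub>0 - 1 \<ge> 1"
    using assms(3) by simp
  then have m: "0 \<le> m" "m < 1"
    by (simp_all add: m_def)
  \<comment> \<open>Uniqueness rests on this: for positive \<open>m\<close> the first branch is
    strictly decreasing and bounds every minimiser from below.\<close>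
  have m_pos: "m > 0" if "\<delta>\<^sub>0 > 1"
    using that by (simp add: m_def)
  have denominator: "6 * \<delta>\<^sub>0\<^sup>2 - 6 * \<delta>\<^sub>0 + 1 = (3 * (2 * \<delta>\<^sub>0 - 1)\<^sup>2 - 1) / 2"
    by (simp add: power2_eq_square algebra_simps)
  have two_m: "2 + m = (3 * (2 * \<delta>\<^sub>0 - 1)\<^sup>2 - 1) / (2 * \<delta>\<^sub>0 - 1)\<^sup>2"
    using L by (simp add: m_def field_simps)
  have \<omega>_eq: "(2 * \<delta>\<^sub>0 - 1)\<^sup>2 / (6 * \<delta>\<^sub>0\<^sup>2 - 6 * \<delta>\<^sub>0 + 1) = \<omega>"
    unfolding denominator \<omega>_def two_m by simp
  have "1 - \<omega> * m = \<rho>" "1 - \<omega> * 2 = - \<rho>" "\<rho> \<ge> 0" "\<omega> \<noteq> 0"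
    using m by (simp_all add: \<omega>_def \<rho>_def field_simps)
  then have upper: "conv_factor J \<delta>\<^sub>0 \<omega> \<le> ereal \<rho>"
    using conv_factor_le[OF assms(2,3), of \<omega>] unfolding m_def[symmetric] by simp
  \<comment> \<open>Of the two absolute values only these branches matter for optimality. They hold
    for every real \<alpha>, including 0, whereas the upper bound is applied only at
    \<omega>.\<close>
  have lower: "1 - \<alpha> * m \<le> r" "\<alpha> * 2 - 1 \<le> r" if "conv_factor J \<delta>\<^sub>0 \<alpha> \<le> ereal r" for \<alpha> r
    using conv_factor_ge[OF assms(2,3), of m \<alpha>] conv_factor_ge[OF assms(2,3), of 2 \<alpha>] that
    by (auto simp: m_def[symmetric] dest: order_trans)
  have le_\<omega>: "\<alpha> \<le> \<omega>" and ge_\<omega>: "m * \<omega> \<le> m * \<alpha>" if "conv_factor J \<delta>\<^sub>0 \<alpha> \<le> ereal \<rho>" for \<alpha>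
    using lower[OF that] \<open>1 - \<omega> * m = \<rho>\<close> \<open>1 - \<omega> * 2 = - \<rho>\<close> by (simp_all add: mult.commute)
  \<comment> \<open>A value below \<rho> would put \<alpha> strictly below \<omega> by the second
    branch and \<open>\<alpha> * m\<close> strictly above \<open>\<omega> * m\<close> by the first,
    which a nonnegative \<open>m\<close> forbids.\<close>
  have min: "ereal \<rho> \<le> conv_factor J \<delta>\<^sub>0 \<alpha>" for \<alpha>
  proof (rule ccontr)
    assume "\<not> ?thesis"
    then obtain r where "conv_factor J \<delta>\<^sub>0 \<alpha> < ereal r" "r < \<rho>"
      unfolding not_le by (auto dest: ereal_dense2)
    then have "\<alpha> * 2 < \<omega> * 2" "\<omega> * m < \<alpha> * m"
      using lower[of \<alpha> r, OF less_imp_le] \<open>1 - \<omega> * m = \<rho>\<close> \<open>1 - \<omega> * 2 = - \<rho>\<close> by simp_all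
    moreover from this have "\<alpha> * m \<le> \<omega> * m"
      using m by (intro mult_right_mono) auto
    ultimately show False by simp
  qed
  show ?thesis
    unfolding \<omega>_eq is_arg_min_def
  proof (intro conjI impI allI)
    show "\<nexists>\<alpha>. True \<and> conv_factor J \<delta>\<^sub>0 \<alpha> < conv_factor J \<delta>\<^sub>0 \<omega>"
      using upper min by (meson leD order_trans)
    fix \<alpha>
    assume "\<delta>\<^sub>0 > 1" and "True \<and> (\<nexists>\<beta>. True \<and> conv_factor J \<delta>\<^sub>0 \<beta> < conv_factor J \<delta>\<^sub>0 \<alpha>)"
    then have "conv_factor J \<delta>\<^sub>0 \<alpha> \<le> conv_factor J \<delta>\<^sub>0 \<omega>"
      by (meson not_less)
    then have "conv_factor J \<delta>\<^sub>0 \<alpha> \<le> ereal \<rho>"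
      using upper by (rule order_trans)
    then show "\<alpha> = \<omega>"
      using le_\<omega>[of \<alpha>] ge_\<omega>[of \<alpha>] m_pos[OF \<open>\<delta>\<^sub>0 > 1\<close>] by simp
  qed simp
qed

end
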